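(* It holds that $$\sup\left\{\frac{|\heartsuit(\mathcal{K})|}{|\mathcal{K}|}:\mathcal{K}\subset\mathbb{R}^2\text{ is a triangle}\right\}=\frac38,$$ and the supremum is approached by a sequence of obtuse triangles, i.e. there is a sequence of obtuse triangles $\mathcal{K}_n$ with $|\heartsuit(\mathcal{K}_n)|/|\mathcal{K}_n|\to\frac38$ as $n\to\infty$.
   Context: A triangle is a closed non-degenerate triangle (with its interior) in $\mathbb{R}^2$, and $|\cdot|$ denotes area. For a compact convex set $\mathcal{K}$ with non-empty interior, $\omega$ in the unit circle $\mathbb{S}^1$ and $\lambda\in\mathbb{R}$, $T_{\lambda,\omega}$ is the reflection of $\mathbb{R}^2$ in the line $\{x:\langle x,\omega\rangle=\lambda\}$, and $\mathcal{K}_{\lambda,\omega}=\{x\in\mathcal{K}:\langle x,\omega\rangle\ge\lambda\}$. The maximal folding function is $\mathcal{R}_{\mathcal{K}}(\omega)=\min\{\lambda\in\mathbb{R}: T_{\lambda,\omega}(\mathcal{K}_{\lambda,\omega})\subseteq\mathcal{K}\}$. The heart of $\mathcal{K}$ is $\heartsuit(\mathcal{K})=\{x\in\mathcal{K}:\langle x,\omega\rangle\le\mathcal{R}_{\mathcal{K}}(\omega)\text{ for every }\omega\in\mathbb{S}^{1}\}$. *)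

theory Defs
  imports "HOL-Analysis.Analysis"
begin

type_synonym plane = "real^2"

definition is_triangle :: "plane set \<Rightarrow> bool" where
  "is_triangle K \<longleftrightarrow> (\<exists>a b c. \<not> collinear {a, b, c} \<and> K = convex hull {a, b, c})"

definition angle_at :: "plane \<Rightarrow> plane \<Rightarrow> plane \<Rightarrow> real" where
  "angle_at a b c = arccos (((b - a) \<bullet> (c - a)) / (norm (b - a) * norm (c - a)))"

text \<open>Since the vertices are quantified, it is no restriction to name the one with the
  obtuse angle \<open>a\<close>.\<close>

definition is_obtuse_triangle :: "plane set \<Rightarrow> bool" where
  "is_obtuse_triangle K \<longleftrightarrow>
     (\<exists>a b c. \<not> collinear {a, b, c} \<and> K = convex hull {a, b, c} \<and> angle_at a b c > pi / 2)"

definition area :: "plane set \<Rightarrow> real" where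
  "area K = measure lebesgue K"

text \<open>The next three definitions are meant for \<open>norm \<omega> = 1\<close>.\<close>

definition reflection :: "real \<Rightarrow> plane \<Rightarrow> plane \<Rightarrow> plane" where
  "reflection l \<omega> x = x - (2 * (x \<bullet> \<omega> - l)) *\<^sub>R \<omega>"

definition cap :: "plane set \<Rightarrow> real \<Rightarrow> plane \<Rightarrow> plane set" where
  "cap K l \<omega> = {x \<in> K. x \<bullet> \<omega> \<ge> l}"

definition max_folding :: "plane set \<Rightarrow> plane \<Rightarrow> real" where
  "max_folding K \<omega> = (LEAST l. reflection l \<omega> ` cap K l \<omega> \<subseteq> K)"

definition heart :: "plane set \<Rightarrow> plane set" where
  "heart K = {x \<in> K. \<forall>\<omega>. norm \<omega> = 1 \<longrightarrow> x \<bullet> \<omega> \<le> max_folding K \<omega>}"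

text \<open>The minimum in \<^const>\<open>max_folding\<close> is attained, so \<open>LEAST\<close> is well defined there.\<close>

lemma max_folding_is_minimum:
  assumes K: "compact K" "K \<noteq> {}" and w: "norm \<omega> = 1"
  shows "reflection (max_folding K \<omega>) \<omega> ` cap K (max_folding K \<omega>) \<omega> \<subseteq> K"
    and "reflection l \<omega> ` cap K l \<omega> \<subseteq> K \<Longrightarrow> max_folding K \<omega> \<le> l"
proof -
  define S where "S = {l. reflection l \<omega> ` cap K l \<omega> \<subseteq> K}"
  have ww: "\<omega> \<bullet> \<omega> = 1" using w by (simp add: norm_eq_1)
  obtain B where B: "\<And>x. x \<in> K \<Longrightarrow> norm x \<le> B"
    using compact_imp_bounded[OF K(1)] by (auto simp: bounded_iff)
  have B': "\<bar>x \<bullet> \<omega>\<bar> \<le> B" if "x \<in> K" for x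
    using Cauchy_Schwarz_ineq2[of x \<omega>] B[OF that] w by simp
  have "S \<noteq> {}"
  proof -
    have "cap K (B + 1) \<omega> = {}" using B' by (force simp: cap_def)
    then have "B + 1 \<in> S" by (simp add: S_def)
    then show ?thesis by blast
  qed
  have low: "- B \<le> l" if "l \<in> S" for l
  proof -
    obtain x where x: "x \<in> K" using K(2) by blast
    show ?thesis
    proof (cases "l > x \<bullet> \<omega>")
      case True then show ?thesis using B'[OF x] by linarith
    next
      case False
      then have "reflection l \<omega> x \<in> K" using that x by (auto simp: S_def cap_def)
      from B'[OF this] have "\<bar>2 * l - x \<bullet> \<omega>\<bar> \<le> B"
        by (simp add: reflection_def inner_diff_left ww)
      then show ?thesis using B'[OF x] by linarith
    qed
  qed
  then have bdd: "bdd_below S" by (auto simp: bdd_below_def)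
  have "S = (\<Inter>x\<in>K. {x \<bullet> \<omega>..} \<union> ((\<lambda>l. reflection l \<omega> x) -` K))"
  proof (intro set_eqI iffI)
    fix l assume "l \<in> S"
    then show "l \<in> (\<Inter>x\<in>K. {x \<bullet> \<omega>..} \<union> ((\<lambda>l. reflection l \<omega> x) -` K))"
      by (auto simp: S_def cap_def image_subset_iff not_le)
  next
    fix l assume l: "l \<in> (\<Inter>x\<in>K. {x \<bullet> \<omega>..} \<union> ((\<lambda>l. reflection l \<omega> x) -` K))"
    have "reflection l \<omega> x \<in> K" if "x \<in> K" "l \<le> x \<bullet> \<omega>" for x
    proof (cases "l = x \<bullet> \<omega>")
      case True then show ?thesis using that by (simp add: reflection_def)
    next
      case False then show ?thesis using that l by auto
    qed
    then show "l \<in> S" by (auto simp: S_def cap_def)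
  qed
  moreover have "closed ((\<lambda>l. reflection l \<omega> x) -` K)" for x
    unfolding reflection_def
    by (intro continuous_closed_vimage compact_imp_closed[OF K(1)] continuous_intros)
  ultimately have "closed S" by (auto intro!: closed_INT closed_Un)
  then have InfS: "Inf S \<in> S" using closed_contains_Inf[OF \<open>S \<noteq> {}\<close> bdd] by blast
  have "max_folding K \<omega> = Inf S"
    unfolding max_folding_def
  proof (rule Least_equality)
    show "reflection (Inf S) \<omega> ` cap K (Inf S) \<omega> \<subseteq> K" using InfS by (simp add: S_def)
    show "Inf S \<le> y" if "reflection y \<omega> ` cap K y \<omega> \<subseteq> K" for y
      using that bdd by (intro cInf_lower) (auto simp: S_def)
  qed
  then show "reflection (max_folding K \<omega>) \<omega> ` cap K (max_folding K \<omega>) \<omega> \<subseteq> K"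
    and "reflection l \<omega> ` cap K l \<omega> \<subseteq> K \<Longrightarrow> max_folding K \<omega> \<le> l"
    using InfS bdd by (auto simp: S_def intro!: cInf_lower)
qed

end

theory Submission
  imports Defs
begin

text \<open>
  A fold that works, i.e. a line such that the part of \<open>K\<close> on one side is reflected into \<open>K\<close>,
  forces the heart to lie on the other side of that line, and the heart consists of the points
  of \<open>K\<close> that no working fold cuts off (\<open>heart_iff\<close>). Both bounds come from this.

  \<^bold>\<open>Upper bound.\<close> Let \<open>AB\<close> be a longest side and \<open>AC\<close> a shortest one. Measure positions in
  the frame with origin \<open>A\<close>, whose axes are the side \<open>e = B - A\<close> and the altitude vector \<open>g\<close>
  from \<open>AB\<close> to \<open>C\<close>. Then \<open>A\<close>, \<open>B\<close>, \<open>C\<close> have coordinates \<open>(0,0)\<close>, \<open>(1,0)\<close>, \<open>(t,1)\<close> with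
  \<open>0 \<le> t \<le> 1/2\<close>. Three folds always work: folding \<open>B\<close> over the perpendicular bisector of \<open>AB\<close>,
  folding \<open>A\<close> over the altitude through \<open>C\<close>, and folding \<open>C\<close> over the bisector of the angle at
  \<open>B\<close>. The first two put the heart in the strip \<open>t \<le> x \<le> 1/2\<close>. The third puts it below a line
  through \<open>B\<close> that meets the altitude at most at half its height, because
  \<open>tan (\<beta>/2) \<le> tan \<beta> / 2\<close>. So the heart lies in the part of the triangle in the strip with all
  heights halved. With \<open>u = 1 - t\<close>, that part has the share \<open>(u - 1/(4u)) / 2\<close> of the area, which increases
  to \<open>3/8\<close> as \<open>u\<close> tends to \<open>1\<close> (\<open>heart_constraints\<close>, \<open>heart_ratio_le\<close>).

  \<^bold>\<open>Sharpness.\<close> The estimates become equalities in the limit \<open>t \<rightarrow> 0\<close> if the triangle flattens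
  much faster than \<open>t\<close>. The triangle with vertices \<open>(0,0)\<close>, \<open>(1,0)\<close>, \<open>(t, t\<^sup>2)\<close> is obtuse, and
  apart from margins of relative width of order \<open>t\<close> every point of the trapezoid above is in its heart:
  a fold that cuts off such a point moves a vertex out of the triangle
  (\<open>fold_exposing_deep_point_fails\<close>). Hence the ratios tend to \<open>3/8\<close>.
\<close>

section \<open>Folds and the heart\<close>

lemma heart_iff:
  assumes "compact K" "K \<noteq> {}"
  shows "x \<in> heart K \<longleftrightarrow>
    x \<in> K \<and> (\<forall>\<omega> l. norm \<omega> = 1 \<longrightarrow> reflection l \<omega> ` cap K l \<omega> \<subseteq> K \<longrightarrow> x \<bullet> \<omega> \<le> l)"
  using max_folding_is_minimum[OF assms] unfolding heart_def by (blast intro: order_trans)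

lemma compact_heart:
  assumes "compact K"
  shows "compact (heart K)"
proof -
  have "heart K = K \<inter> (\<Inter>\<omega>\<in>sphere 0 1. {x. \<omega> \<bullet> x \<le> max_folding K \<omega>})"
    by (auto simp: heart_def inner_commute)
  then show ?thesis
    using assms by (auto intro!: compact_Int_closed closed_INT closed_halfspace_le)
qed

text \<open>The normal \<open>v\<close> of the fold line through \<open>M\<close> need not be a unit vector, so that sides of a
  triangle can serve as normals and no square roots appear.\<close>

lemma heart_beyond_fold:
  assumes K: "compact K" "K \<noteq> {}" and v: "v \<noteq> 0"
    and fold: "\<And>P. P \<in> K \<Longrightarrow> 0 \<le> (P - M) \<bullet> v \<Longrightarrow> P - (2 * ((P - M) \<bullet> v) / (v \<bullet> v)) *\<^sub>R v \<in> K"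
    and x: "x \<in> heart K"
  shows "(x - M) \<bullet> v \<le> 0"
proof -
  define \<omega> where "\<omega> = v /\<^sub>R norm v"
  have nv: "norm v > 0" "v \<bullet> v = norm v * norm v"
    using v by (auto simp: power2_norm_eq_inner[symmetric] power2_eq_square)
  have \<omega>: "norm \<omega> = 1" using v by (simp add: \<omega>_def)
  have d: "P \<bullet> \<omega> - M \<bullet> \<omega> = ((P - M) \<bullet> v) / norm v" for P
    by (simp add: \<omega>_def inner_diff_left divide_inverse algebra_simps)
  have r: "reflection (M \<bullet> \<omega>) \<omega> P = P - (2 * ((P - M) \<bullet> v) / (v \<bullet> v)) *\<^sub>R v" for P
    unfolding reflection_def d nv(2) by (simp add: \<omega>_def divide_inverse)
  have "reflection (M \<bullet> \<omega>) \<omega> ` cap K (M \<bullet> \<omega>) \<omega> \<subseteq> K"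
  proof (clarsimp simp: cap_def)
    fix P assume P: "P \<in> K" "M \<bullet> \<omega> \<le> P \<bullet> \<omega>"
    then have "0 \<le> ((P - M) \<bullet> v) / norm v" using d[of P] by simp
    then have "0 \<le> (P - M) \<bullet> v" using nv by (simp add: zero_le_divide_iff)
    then show "reflection (M \<bullet> \<omega>) \<omega> P \<in> K" using fold P by (simp add: r)
  qed
  then have "x \<bullet> \<omega> \<le> M \<bullet> \<omega>" using x \<omega> heart_iff[OF K] by blast
  then have "((x - M) \<bullet> v) / norm v \<le> 0" using d[of x] by simp
  then show ?thesis unfolding pos_divide_le_eq[OF nv(1)] by simp
qed

text \<open>Reflection in the bisector of an angle at \<open>V\<close> with unit directions \<open>p\<close> and \<open>q\<close> just swaps the
  coordinates along \<open>p\<close> and \<open>q\<close>; the fold moves the side \<open>\<alpha> \<le> \<gamma>\<close>, on which \<open>q\<close> lies.\<close>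

lemma heart_beyond_bisector:
  assumes K: "compact K" "K \<noteq> {}" and unit: "norm p = 1" "norm q = 1" and pq: "p \<noteq> q"
    and fold: "\<And>P. P \<in> K \<Longrightarrow>
      \<exists>\<alpha> \<gamma>. P = V + \<alpha> *\<^sub>R p + \<gamma> *\<^sub>R q \<and> (\<alpha> \<le> \<gamma> \<longrightarrow> V + \<gamma> *\<^sub>R p + \<alpha> *\<^sub>R q \<in> K)"
    and x: "V + \<alpha> *\<^sub>R p + \<gamma> *\<^sub>R q \<in> heart K"
  shows "\<gamma> \<le> \<alpha>"
proof -
  define v where "v = q - p"
  have pp: "p \<bullet> p = 1" "q \<bullet> q = 1" using unit by (auto simp: norm_eq_1)
  have vv: "v \<bullet> v = 2 * (1 - p \<bullet> q)"
    by (simp add: v_def inner_diff_left inner_diff_right pp inner_commute)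
  moreover have "v \<bullet> v > 0" using pq by (simp add: v_def)
  ultimately have pos: "1 - p \<bullet> q > 0" by simp
  have d: "(V + \<alpha> *\<^sub>R p + \<gamma> *\<^sub>R q - V) \<bullet> v = (\<gamma> - \<alpha>) * (1 - p \<bullet> q)" for \<alpha> \<gamma>
    by (simp add: v_def inner_diff_right inner_add_left pp inner_commute algebra_simps)
  have "(V + \<alpha> *\<^sub>R p + \<gamma> *\<^sub>R q - V) \<bullet> v \<le> 0"
  proof (rule heart_beyond_fold[OF K _ _ x])
    show "v \<noteq> 0" using pq by (simp add: v_def)
    fix P assume P: "P \<in> K" "0 \<le> (P - V) \<bullet> v"
    obtain a c where ac: "P = V + a *\<^sub>R p + c *\<^sub>R q" "a \<le> c \<longrightarrow> V + c *\<^sub>R p + a *\<^sub>R q \<in> K"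
      using fold[OF P(1)] by blast
    have "a \<le> c" using P(2) pos unfolding ac(1) d by (simp add: zero_le_mult_iff)
    have "2 * ((c - a) * k) / (2 * k) = c - a" if "0 < k" for k using that by simp
    then have coeff: "2 * ((P - V) \<bullet> v) / (v \<bullet> v) = c - a"
      unfolding ac(1) d vv using pos by blast
    have "P - (2 * ((P - V) \<bullet> v) / (v \<bullet> v)) *\<^sub>R v = V + c *\<^sub>R p + a *\<^sub>R q"
      unfolding coeff unfolding ac(1) v_def by (simp add: algebra_simps)
    then show "P - (2 * ((P - V) \<bullet> v) / (v \<bullet> v)) *\<^sub>R v \<in> K" using ac(2) \<open>a \<le> c\<close> by simp
  qed
  then show ?thesis using pos unfolding d by (simp add: mult_le_0_iff)
qed

section \<open>Triangles in an oblique frame\<close>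

text \<open>Frame coordinates depend affinely on the point, so convex combinations can be computed in
  coordinates.\<close>

lemma frame_in_hull:
  fixes A e g :: "'a::real_vector"
  assumes "0 \<le> u" "0 \<le> v" "0 \<le> w" "u + v + w = 1"
    and "x = u * x1 + v * x2 + w * x3" "y = u * y1 + v * y2 + w * y3"
  shows "A + x *\<^sub>R e + y *\<^sub>R g
    \<in> convex hull {A + x1 *\<^sub>R e + y1 *\<^sub>R g, A + x2 *\<^sub>R e + y2 *\<^sub>R g, A + x3 *\<^sub>R e + y3 *\<^sub>R g}"
proof -
  have "A + x *\<^sub>R e + y *\<^sub>R g = (u + v + w) *\<^sub>R A + x *\<^sub>R e + y *\<^sub>R g" using assms(4) by simp
  also have "\<dots> = u *\<^sub>R (A + x1 *\<^sub>R e + y1 *\<^sub>R g) + v *\<^sub>R (A + x2 *\<^sub>R e + y2 *\<^sub>R g)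
      + w *\<^sub>R (A + x3 *\<^sub>R e + y3 *\<^sub>R g)"
    unfolding assms(5,6) by (simp add: algebra_simps)
  finally show ?thesis unfolding convex_hull_3 using assms(1-4) by blast
qed

lemma area_frame_triangle:
  fixes A e g :: plane
  shows "area (convex hull {A + x1 *\<^sub>R e + y1 *\<^sub>R g, A + x2 *\<^sub>R e + y2 *\<^sub>R g, A + x3 *\<^sub>R e + y3 *\<^sub>R g}) =
    \<bar>e $ 1 * g $ 2 - e $ 2 * g $ 1\<bar> * \<bar>(x2 - x1) * (y3 - y1) - (x3 - x1) * (y2 - y1)\<bar> / 2"
    (is "area ?H = _")
proof -
  have "compact ?H" by (simp add: finite_imp_compact_convex_hull)
  then have "area ?H = measure lborel ?H"
    by (simp add: area_def borel_compact)
  then show ?thesis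
    unfolding content_triangle abs_mult[symmetric]
    by (simp add: algebra_simps abs_minus_commute)
qed

lemma frame_triangle_mem:
  fixes A e g :: "'a::real_vector"
  assumes "P \<in> convex hull {A, A + e, A + t *\<^sub>R e + g}"
  obtains x c where "P = A + x *\<^sub>R e + c *\<^sub>R g" "0 \<le> c" "t * c \<le> x" "x \<le> 1 - (1 - t) * c"
proof -
  obtain u v w where uvw: "0 \<le> u" "0 \<le> v" "0 \<le> w" "u + v + w = 1"
    "P = u *\<^sub>R A + v *\<^sub>R (A + e) + w *\<^sub>R (A + t *\<^sub>R e + g)"
    using assms unfolding convex_hull_3 by blast
  have "P = (u + v + w) *\<^sub>R A + (v + t * w) *\<^sub>R e + w *\<^sub>R g"
    unfolding uvw(5) by (simp add: algebra_simps)
  then have "P = A + (v + t * w) *\<^sub>R e + w *\<^sub>R g" using uvw(4) by simp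
  moreover have "v + t * w \<le> 1 - (1 - t) * w" using uvw by (simp add: algebra_simps)
  ultimately show ?thesis using that uvw by simp
qed

lemma frame_triangle_memI:
  fixes A e g :: "'a::real_vector"
  assumes "0 \<le> c" "t * c \<le> x" "x \<le> 1 - (1 - t) * c"
  shows "A + x *\<^sub>R e + c *\<^sub>R g \<in> convex hull {A, A + e, A + t *\<^sub>R e + g}"
  using frame_in_hull[of "1 - x - (1 - t) * c" "x - t * c" c x 0 1 t c 0 0 1 A e g] assms
  by (simp add: algebra_simps)

section \<open>The upper bound\<close>

text \<open>The hypotheses on \<open>t\<close> and \<open>long\<close> say that the side along \<open>e\<close> is at least as long as the
  side opposite \<open>A\<close>, which is at least as long as the side opposite \<open>A + e\<close>.

  In each of the three folds a longer piece receives a shorter one. In the fold over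
  the bisector at \<open>A + e\<close>, the half with the side of length \<open>m\<close> lands inside because that side is
  folded onto the side of length \<open>L \<ge> m\<close>. This gives \<open>c * m \<le> a * L\<close> for the barycentric
  coordinates \<open>c\<close> and \<open>a\<close> at the apex and at \<open>A\<close>. The projection of the side of length \<open>m\<close> to the
  base has length \<open>(1 - t) * L\<close>, at most \<open>m\<close>, so the cruder linear bound \<open>(1 - t) * c \<le> a\<close> follows.\<close>

lemma heart_constraints:
  fixes A e g :: plane
  assumes e: "e \<noteq> 0" and g: "g \<noteq> 0" and eg: "e \<bullet> g = 0" and t: "0 \<le> t" "t \<le> 1/2"
    and long: "(1 - t)\<^sup>2 * (e \<bullet> e) + g \<bullet> g \<le> e \<bullet> e"
    and P: "P \<in> heart (convex hull {A, A + e, A + t *\<^sub>R e + g})"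
  obtains x c where "P = A + x *\<^sub>R e + c *\<^sub>R g" "t \<le> x" "x \<le> 1/2" "0 \<le> c" "2 * (1 - t) * c \<le> 1 - x"
proof -
  define K where "K = convex hull {A, A + e, A + t *\<^sub>R e + g}"
  have K: "compact K" "K \<noteq> {}" by (auto simp: K_def finite_imp_compact_convex_hull)
  have PK: "P \<in> heart K" using P by (simp add: K_def)
  then have "P \<in> K" by (simp add: heart_def)
  then obtain x c where xc: "P = A + x *\<^sub>R e + c *\<^sub>R g" "0 \<le> c" "t * c \<le> x" "x \<le> 1 - (1 - t) * c"
    unfolding K_def by (rule frame_triangle_mem)
  have ee: "e \<bullet> e > 0" using e by simp
  have c1: "c \<le> 1" if "t * c \<le> x" "x \<le> 1 - (1 - t) * c" for x c
    using that by (simp add: algebra_simps)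
  have de: "(A + x *\<^sub>R e + c *\<^sub>R g - (A + s *\<^sub>R e)) \<bullet> e = (x - s) * (e \<bullet> e)" for x c s
    using eg by (simp add: inner_add_left inner_diff_left inner_commute algebra_simps)
  \<comment> \<open>The fold over the perpendicular bisector of the base replaces \<open>x\<close> by \<open>1 - x\<close>.\<close>
  have cancel: "2 * ((x - 1/2) * (e \<bullet> e)) / (e \<bullet> e) = x - (1 - x)" for x using ee by simp
  have "(P - (A + (1/2) *\<^sub>R e)) \<bullet> e \<le> 0"
  proof (rule heart_beyond_fold[OF K e _ PK])
    fix Q assume Q: "Q \<in> K" "0 \<le> (Q - (A + (1/2) *\<^sub>R e)) \<bullet> e"
    obtain x c where q: "Q = A + x *\<^sub>R e + c *\<^sub>R g" "0 \<le> c" "t * c \<le> x" "x \<le> 1 - (1 - t) * c"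
      using Q(1) unfolding K_def by (rule frame_triangle_mem)
    have x: "x \<ge> 1/2" using Q(2) ee unfolding q(1) de by (simp add: zero_le_mult_iff)
    have "Q - (2 * ((Q - (A + (1/2) *\<^sub>R e)) \<bullet> e) / (e \<bullet> e)) *\<^sub>R e = A + (1 - x) *\<^sub>R e + c *\<^sub>R g"
      unfolding q(1) de cancel scaleR_diff_left[of x "1 - x"] by simp
    moreover have "t * c \<le> (1 - t) * c" using t q(2) by (intro mult_right_mono) auto
    then have "A + (1 - x) *\<^sub>R e + c *\<^sub>R g \<in> K"
      unfolding K_def using q x by (intro frame_triangle_memI) linarith+
    ultimately show "Q - (2 * ((Q - (A + (1/2) *\<^sub>R e)) \<bullet> e) / (e \<bullet> e)) *\<^sub>R e \<in> K" by simp
  qed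
  then have x_le: "x \<le> 1/2" using ee unfolding xc(1) de by (simp add: mult_le_0_iff)
  \<comment> \<open>The fold over the altitude moves the points left of it and replaces \<open>x\<close> by \<open>2 * t - x\<close>.\<close>
  have "(P - (A + t *\<^sub>R e)) \<bullet> (- e) \<le> 0"
  proof (rule heart_beyond_fold[OF K _ _ PK])
    show "- e \<noteq> 0" using e by simp
    fix Q assume Q: "Q \<in> K" "0 \<le> (Q - (A + t *\<^sub>R e)) \<bullet> (- e)"
    obtain x c where q: "Q = A + x *\<^sub>R e + c *\<^sub>R g" "0 \<le> c" "t * c \<le> x" "x \<le> 1 - (1 - t) * c"
      using Q(1) unfolding K_def by (rule frame_triangle_mem)
    have x: "x \<le> t" using Q(2) ee unfolding q(1) inner_minus_right de
      by (simp add: mult_le_0_iff)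
    have coeff: "2 * ((Q - (A + t *\<^sub>R e)) \<bullet> (- e)) / (- e \<bullet> - e) = - (x - (2 * t - x))"
      unfolding q(1) inner_minus_right inner_minus_left de using ee by (simp add: field_simps)
    have "Q - (2 * ((Q - (A + t *\<^sub>R e)) \<bullet> (- e)) / (- e \<bullet> - e)) *\<^sub>R (- e)
        = A + (2 * t - x) *\<^sub>R e + c *\<^sub>R g"
      unfolding coeff unfolding scaleR_minus_left scaleR_minus_right scaleR_diff_left[of x] q(1) by simp
    moreover have "t * c \<le> t * 1" "(1 - 2 * t) * c \<le> (1 - 2 * t) * 1"
      using t c1[OF q(3,4)] by (intro mult_left_mono; simp)+
    then have "A + (2 * t - x) *\<^sub>R e + c *\<^sub>R g \<in> K"
      unfolding K_def using q x by (intro frame_triangle_memI) (auto simp: algebra_simps)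
    ultimately show "Q - (2 * ((Q - (A + t *\<^sub>R e)) \<bullet> (- e)) / (- e \<bullet> - e)) *\<^sub>R (- e) \<in> K" by simp
  qed
  then have x_ge: "t \<le> x" using ee unfolding xc(1) inner_minus_right de by (simp add: zero_le_mult_iff)
  \<comment> \<open>The fold over the angle bisector at \<open>A + e\<close>; \<open>p\<close> points to \<open>A\<close> and \<open>q\<close> to the apex.\<close>
  define L m where "L = norm e" and "m = norm (g - (1 - t) *\<^sub>R e)"
  have m2: "m\<^sup>2 = (1 - t)\<^sup>2 * (e \<bullet> e) + g \<bullet> g"
    unfolding m_def power2_norm_eq_inner using eg
    by (simp add: inner_diff_left inner_diff_right inner_commute power2_eq_square)
  have L2: "L\<^sup>2 = e \<bullet> e" by (simp add: L_def power2_norm_eq_inner)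
  have L0: "L > 0" using e by (simp add: L_def)
  have "m\<^sup>2 \<le> L\<^sup>2" unfolding m2 L2 by (rule long)
  then have "m \<le> L" using L0 by (rule power2_le_imp_le[OF _ less_imp_le])
  have "((1 - t) * L)\<^sup>2 < m\<^sup>2" unfolding m2 power_mult_distrib L2 using g by simp
  then have tLm: "(1 - t) * L < m" by (rule power2_less_imp_less) (simp add: m_def)
  then have m0: "m > 0" using L0 t mult_nonneg_nonneg[of "1 - t" L] by linarith
  define p q where "p = - e /\<^sub>R L" and "q = (g - (1 - t) *\<^sub>R e) /\<^sub>R m"
  have Lp: "L *\<^sub>R p = - e" and mq: "m *\<^sub>R q = g - (1 - t) *\<^sub>R e"
    using L0 m0 by (auto simp: p_def q_def)
  have split: "A + x *\<^sub>R e + c *\<^sub>R g = (A + e) + ((1 - x - (1 - t) * c) * L) *\<^sub>R p + (c * m) *\<^sub>R q" for x c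
    unfolding scaleR_scaleR[symmetric] Lp mq by (simp add: algebra_simps)
  have "c * m \<le> (1 - x - (1 - t) * c) * L"
  proof (rule heart_beyond_bisector[OF K])
    show "norm p = 1" "norm q = 1" using L0 m0 by (auto simp: p_def q_def L_def m_def)
    show "p \<noteq> q"
    proof
      assume "p = q"
      then have "p \<bullet> g = q \<bullet> g" by simp
      then show False using eg m0 g by (simp add: p_def q_def inner_diff_left)
    qed
    show "A + e + ((1 - x - (1 - t) * c) * L) *\<^sub>R p + (c * m) *\<^sub>R q \<in> heart K"
      using PK unfolding xc(1) split .
    fix Q assume "Q \<in> K"
    then obtain x c where q: "Q = A + x *\<^sub>R e + c *\<^sub>R g" "0 \<le> c" "t * c \<le> x" "x \<le> 1 - (1 - t) * c"
      unfolding K_def by (rule frame_triangle_mem)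
    define a where "a = 1 - x - (1 - t) * c"
    have a: "a \<ge> 0" "a + c \<le> 1" using q by (auto simp: a_def algebra_simps)
    \<comment> \<open>\<open>a'\<close> and \<open>c'\<close> are the barycentric coordinates of the reflected point at \<open>A\<close> and at the
      apex; since they are nonnegative, it remains to see that their sum is at most 1.\<close>
    define a' c' where "a' = c * m / L" and "c' = a * L / m"
    have ac': "a' * L = c * m" "c' * m = a * L" using L0 m0 by (auto simp: a'_def c'_def)
    have pos: "0 \<le> a'" "0 \<le> c'" using L0 m0 a q(2) by (auto simp: a'_def c'_def)
    have "A + e + (c * m) *\<^sub>R p + (a * L) *\<^sub>R q \<in> K" if le: "a * L \<le> c * m"
    proof -
      have "c - a' = c * (L - m) / L" "c' - a = a * (L - m) / m"
        using L0 m0 by (auto simp: a'_def c'_def field_simps)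
      moreover have "a * (L - m) / m \<le> c * (L - m) / L"
      proof -
        have "(a * L) * (L - m) \<le> (c * m) * (L - m)"
          using le \<open>m \<le> L\<close> by (intro mult_right_mono) auto
        then show ?thesis using L0 m0 by (simp add: field_simps)
      qed
      ultimately have sum: "a' + c' \<le> 1" using a by linarith
      have "A + (1 - a' - (1 - t) * c') *\<^sub>R e + c' *\<^sub>R g \<in> K"
        unfolding K_def using pos sum by (intro frame_triangle_memI) (auto simp: algebra_simps)
      moreover have "1 - (1 - a' - (1 - t) * c') - (1 - t) * c' = a'" by simp
      ultimately show ?thesis unfolding split ac' by (simp add: ac')
    qed
    then show "\<exists>\<alpha> \<gamma>. Q = A + e + \<alpha> *\<^sub>R p + \<gamma> *\<^sub>R q \<and>
        (\<alpha> \<le> \<gamma> \<longrightarrow> A + e + \<gamma> *\<^sub>R p + \<alpha> *\<^sub>R q \<in> K)"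
      unfolding q(1) split a_def by blast
  qed
  moreover have "c * ((1 - t) * L) \<le> c * m" using tLm xc(2) by (intro mult_left_mono) auto
  ultimately have "(c * (1 - t)) * L \<le> (1 - x - (1 - t) * c) * L" by (simp add: algebra_simps)
  then have "c * (1 - t) \<le> 1 - x - (1 - t) * c" using L0 by (simp only: mult_le_cancel_right_pos)
  then have "2 * (1 - t) * c \<le> 1 - x" by (simp add: algebra_simps)
  then show ?thesis using that xc x_le x_ge by blast
qed

text \<open>A trapezoid is cut by a diagonal into two triangles, whose areas are known. At \<open>t = 1/2\<close>
  both collapse into a segment.\<close>

lemma trapezoid_cover:
  fixes A e g :: plane
  assumes t: "t \<le> 1/2" and x: "t \<le> x" "x \<le> 1/2" and c: "0 \<le> c" "2 * (1 - t) * c \<le> 1 - x"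
  defines "y \<equiv> 1 / (4 * (1 - t))"
  shows "A + x *\<^sub>R e + c *\<^sub>R g \<in>
      convex hull {A + t *\<^sub>R e + 0 *\<^sub>R g, A + (1/2) *\<^sub>R e + 0 *\<^sub>R g, A + (1/2) *\<^sub>R e + y *\<^sub>R g}
    \<union> convex hull {A + t *\<^sub>R e + 0 *\<^sub>R g, A + (1/2) *\<^sub>R e + y *\<^sub>R g, A + t *\<^sub>R e + (1/2) *\<^sub>R g}"
proof -
  obtain s where s: "0 \<le> s" "s \<le> 1" "x = t + s * (1/2 - t)"
  proof (cases "t = 1/2")
    case True
    then show ?thesis using that[of 0] x by simp
  next
    case False
    then have k: "1/2 - t > 0" using t by simp
    have "(x - t) / (1/2 - t) \<le> 1" unfolding pos_divide_le_eq[OF k] using x by simp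
    moreover have "0 \<le> (x - t) / (1/2 - t)" using k x by simp
    moreover have "x = t + (x - t) / (1/2 - t) * (1/2 - t)" using k by simp
    ultimately show ?thesis using that by blast
  qed
  have t1: "4 * (1 - t) > 0" using t by simp
  have y: "y > 0" "4 * (1 - t) * y = 1" using t1 by (auto simp: y_def)
  have top: "c \<le> (1 - s) / 2 + s * y"
  proof -
    have "4 * (1 - t) * ((1 - s) / 2 + s * y) = 2 * (1 - t) * (1 - s) + s * (4 * (1 - t) * y)"
      by (simp add: field_simps)
    also have "\<dots> = 2 * (1 - x)" unfolding y(2) s(3) by (simp add: field_simps)
    also have "2 * (1 - x) \<ge> 2 * (2 * (1 - t) * c)" using c(2) by (intro mult_left_mono) auto
    also have "2 * (2 * (1 - t) * c) = 4 * (1 - t) * c" by simp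
    finally have "4 * (1 - t) * c \<le> 4 * (1 - t) * ((1 - s) / 2 + s * y)" .
    then show ?thesis using t1 by (simp only: mult_le_cancel_left_pos)
  qed
  show ?thesis
  proof (cases "c \<le> s * y")
    case True
    define r where "r = c / y"
    have r: "c = r * y" "0 \<le> r" "r \<le> s"
      using True y(1) c(1) by (auto simp: r_def pos_divide_le_eq)
    have "A + x *\<^sub>R e + c *\<^sub>R g \<in>
      convex hull {A + t *\<^sub>R e + 0 *\<^sub>R g, A + (1/2) *\<^sub>R e + 0 *\<^sub>R g, A + (1/2) *\<^sub>R e + y *\<^sub>R g}"
      unfolding s(3) r(1)
      by (rule frame_in_hull[of "1 - s" "s - r" r]) (use s(1,2) r(2,3) in \<open>simp_all add: field_simps\<close>)
    then show ?thesis by blast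
  next
    case False
    have c_le: "2 * c \<le> 1 - s + 2 * (s * y)" using top by (simp add: field_simps)
    have "A + x *\<^sub>R e + c *\<^sub>R g \<in>
      convex hull {A + t *\<^sub>R e + 0 *\<^sub>R g, A + (1/2) *\<^sub>R e + y *\<^sub>R g, A + t *\<^sub>R e + (1/2) *\<^sub>R g}"
      unfolding s(3)
      by (rule frame_in_hull[of "1 - s - 2 * (c - s * y)" s "2 * (c - s * y)"])
        (use False s(1,2) c_le in \<open>simp_all add: field_simps\<close>)
    then show ?thesis by blast
  qed
qed

lemma lmeasurable_hull3: "convex hull {A, B, C :: plane} \<in> lmeasurable"
  by (intro lmeasurable_compact finite_imp_compact_convex_hull) auto

lemma heart_ratio_le_frame:
  fixes A e g :: plane
  assumes e: "e \<noteq> 0" and g: "g \<noteq> 0" and eg: "e \<bullet> g = 0" and t: "0 \<le> t" "t \<le> 1/2"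
    and long: "(1 - t)\<^sup>2 * (e \<bullet> e) + g \<bullet> g \<le> e \<bullet> e"
  defines "K \<equiv> convex hull {A, A + e, A + t *\<^sub>R e + g}"
  shows "area (heart K) / area K \<le> 3 / 8"
proof -
  define \<Delta> where "\<Delta> = \<bar>e $ 1 * g $ 2 - e $ 2 * g $ 1\<bar>"
  define u where "u = 1 - t"
  define y where "y = 1 / (4 * (1 - t))"
  define R1 where "R1 = convex hull {A + t *\<^sub>R e + 0 *\<^sub>R g, A + (1/2) *\<^sub>R e + 0 *\<^sub>R g, A + (1/2) *\<^sub>R e + y *\<^sub>R g}"
  define R2 where "R2 = convex hull {A + t *\<^sub>R e + 0 *\<^sub>R g, A + (1/2) *\<^sub>R e + y *\<^sub>R g, A + t *\<^sub>R e + (1/2) *\<^sub>R g}"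
  have "heart K \<subseteq> R1 \<union> R2"
  proof
    fix P assume "P \<in> heart K"
    then obtain x c where "P = A + x *\<^sub>R e + c *\<^sub>R g" "t \<le> x" "x \<le> 1/2" "0 \<le> c" "2 * (1 - t) * c \<le> 1 - x"
      unfolding K_def using heart_constraints[OF e g eg t long] by metis
    then show "P \<in> R1 \<union> R2"
      unfolding R1_def R2_def y_def using trapezoid_cover t by blast
  qed
  then have "area (heart K) \<le> area (R1 \<union> R2)"
    unfolding area_def R1_def R2_def K_def
    by (intro measure_mono_fmeasurable fmeasurableD lmeasurable_compact compact_heart
        fmeasurable.Un lmeasurable_hull3 finite_imp_compact_convex_hull) auto
  also have "\<dots> \<le> area R1 + area R2"
    unfolding area_def R1_def R2_def by (intro measure_Un_le fmeasurableD lmeasurable_hull3)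
  also have "area R1 = \<Delta> * ((1/2 - t) * y) / 2"
    unfolding R1_def area_frame_triangle \<Delta>_def[symmetric] using t by (simp add: abs_mult y_def)
  also have "area R2 = \<Delta> * ((1/2 - t) / 2) / 2"
    unfolding R2_def area_frame_triangle \<Delta>_def[symmetric] using t by (simp add: abs_mult)
  also have "\<Delta> * ((1/2 - t) * y) / 2 + \<Delta> * ((1/2 - t) / 2) / 2
      = \<Delta> / 2 * ((1/2 - t) * y + (1/2 - t) / 2)"
    by (simp only: distrib_left times_divide_eq_left)
  also have "(1/2 - t) * y + (1/2 - t) / 2 = (u - 1 / (4 * u)) / 2"
    using t by (simp add: y_def u_def field_simps)
  also have "\<Delta> / 2 * ((u - 1 / (4 * u)) / 2) \<le> \<Delta> / 2 * (3 / 8)"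
  proof (intro mult_left_mono)
    have "1 / (4 * u) \<ge> 1/4" "u \<le> 1" using t by (auto simp: u_def field_simps)
    then show "(u - 1 / (4 * u)) / 2 \<le> 3 / 8" by simp
  qed (simp add: \<Delta>_def)
  also have "\<Delta> / 2 = area K"
    using area_frame_triangle[of A 0 e 0 g 1 0 t 1] by (simp add: K_def \<Delta>_def)
  finally have "area (heart K) \<le> area K * (3 / 8)" .
  moreover have "area K \<ge> 0" by (simp add: area_def)
  ultimately show ?thesis by (cases "area K = 0") (auto simp: field_simps)
qed

text \<open>Choosing the foot of the altitude from \<open>C\<close> reduces an arbitrary triangle, with its vertices
  labelled by the lengths of the sides, to the frame. That the two longer sides are opposite
  \<open>A\<close> and \<open>C\<close> is what places the foot in the half of \<open>AB\<close> next to \<open>A\<close>.\<close>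

lemma heart_ratio_le_ordered:
  fixes A B C :: plane
  assumes nc: "\<not> collinear {A, B, C}"
    and sides: "dist A C \<le> dist B C" "dist B C \<le> dist A B"
  shows "area (heart (convex hull {A, B, C})) / area (convex hull {A, B, C}) \<le> 3 / 8"
proof -
  define e where "e = B - A"
  define t where "t = ((C - A) \<bullet> e) / (e \<bullet> e)"
  define g where "g = C - A - t *\<^sub>R e"
  have e: "e \<noteq> 0" using nc by (auto simp: e_def)
  have B: "B = A + e" and C: "C = A + t *\<^sub>R e + g" by (auto simp: e_def g_def)
  have eg: "e \<bullet> g = 0" using e by (simp add: g_def t_def inner_diff_right inner_diff_left inner_commute)
  have g: "g \<noteq> 0"
  proof
    assume "g = 0"
    then have "collinear {0, B - A, C - A}" unfolding collinear_lemma by (auto simp: B C)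
    then have "collinear {A, B, C}"
      using collinear_3[of B A C] by (simp add: insert_commute)
    then show False using nc by simp
  qed
  have CA: "(dist A C)\<^sup>2 = t\<^sup>2 * (e \<bullet> e) + g \<bullet> g"
    unfolding dist_commute[of A] dist_norm power2_norm_eq_inner C using eg
    by (simp add: inner_add_left inner_add_right inner_diff_left inner_diff_right inner_commute power2_eq_square)
  have CB: "(dist B C)\<^sup>2 = (1 - t)\<^sup>2 * (e \<bullet> e) + g \<bullet> g"
    unfolding dist_norm power2_norm_eq_inner B C using eg
    by (simp add: inner_add_left inner_add_right inner_diff_left inner_diff_right inner_commute power2_eq_square algebra_simps)
  have AB: "(dist A B)\<^sup>2 = e \<bullet> e"
    by (simp add: dist_norm norm_minus_commute[of A B] power2_norm_eq_inner e_def)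
  have long: "(1 - t)\<^sup>2 * (e \<bullet> e) + g \<bullet> g \<le> e \<bullet> e"
    using power_mono[OF sides(2), of 2] CB AB by simp
  have ee: "e \<bullet> e > 0" using e by simp
  have "t\<^sup>2 * (e \<bullet> e) \<le> (1 - t)\<^sup>2 * (e \<bullet> e)"
    using power_mono[OF sides(1), of 2] CB CA by simp
  then have "t\<^sup>2 \<le> (1 - t)\<^sup>2" using ee by simp
  then have t1: "t \<le> 1/2" by (simp add: power2_eq_square algebra_simps)
  have "(1 - t)\<^sup>2 * (e \<bullet> e) \<le> 1 * (e \<bullet> e)" using long inner_ge_zero[of g] by linarith
  then have "(1 - t)\<^sup>2 \<le> 1\<^sup>2" using ee by (simp del: mult_1)
  then have "1 - t \<le> 1" by (rule power2_le_imp_le) simp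
  then have t0: "0 \<le> t" by simp
  show ?thesis using heart_ratio_le_frame[OF e g eg t0 t1 long, of A] unfolding B[symmetric] C[symmetric] .
qed

lemma heart_ratio_le:
  assumes "is_triangle K"
  shows "area (heart K) / area K \<le> 3 / 8"
proof -
  have *: "area (heart (convex hull {a, b, c})) / area (convex hull {a, b, c}) \<le> 3 / 8"
    if "\<not> collinear {a, b, c}" for a b c :: plane
    using heart_ratio_le_ordered[of a b c] heart_ratio_le_ordered[of b a c]
      heart_ratio_le_ordered[of a c b] heart_ratio_le_ordered[of c a b]
      heart_ratio_le_ordered[of b c a] heart_ratio_le_ordered[of c b a] that
    by (simp add: insert_commute dist_commute) linarith
  then show ?thesis using assms unfolding is_triangle_def by blast
qed

section \<open>Flat obtuse triangles\<close>

text \<open>\<open>T\<close> is the triangle with vertices \<open>A = (0, 0)\<close>, \<open>B = (1, 0)\<close>, \<open>C = (t, h)\<close>, and \<open>(p, q)\<close> is a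
  point of its limiting heart, kept away from the vertical sides by about \<open>t\<close>. Suppose that the fold in direction
  \<open>(w1, w2)\<close> cuts off this point. The vertices on its side, which are those with nonnegative
  \<open>dA\<close>, \<open>dB\<close>, \<open>dC\<close>, must return into \<open>T\<close>, and this fails for each orientation of the fold:

  \<^item> to the right and down or horizontally, \<open>B\<close> moves. To stay below the side \<open>BC\<close> its motion must
    be almost horizontal, and then it passes beyond \<open>x = 0\<close>, as \<open>p\<close> is below \<open>1/2\<close>.
  \<^item> to the right and up, \<open>B\<close> would move below the base, so it cannot be on the moving side. Then
    the fold line is almost horizontal, and \<open>C\<close> moves below the base, as \<open>(p, q)\<close> is below the
    line from \<open>B\<close> to the midpoint of the altitude by a factor \<open>1 - t\<close>.
  \<^item> to the left and down or horizontally, \<open>A\<close> moves. To stay below \<open>AC\<close> its motion must be almost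
    horizontal, and then \<open>C\<close> moves as well, as \<open>p\<close> exceeds \<open>t\<close>, and crosses the side \<open>BC\<close>.
  \<^item> to the left and up, \<open>A\<close> cannot be on the moving side, the fold line is almost horizontal, and
    \<open>C\<close> again moves below the base.

  The direction of the fold deviates from the limiting one by at most the order \<open>h/t = t\<close>, and the
  effect of this is of smaller order than the margin \<open>t\<close>. This is why \<open>h = t\<^sup>2\<close> is flat enough.\<close>

lemma fold_exposing_deep_point_fails:
  fixes t h p q l w1 w2 :: real
  defines "T \<equiv> {(x, y). 0 \<le> y \<and> t * y \<le> h * x \<and> (1 - t) * y \<le> h * (1 - x)}"
  assumes t: "0 < t" "t \<le> 1/4" and h: "h = t\<^sup>2"
    and p: "2 * t \<le> p" "p \<le> 1/2 - t" and q: "0 \<le> q" "2 * q \<le> h * (1 - p)"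
    and w: "w1\<^sup>2 + w2\<^sup>2 = 1"
    and fold: "\<And>x y. (x, y) \<in> {(0, 0), (1, 0), (t, h)} \<Longrightarrow> l \<le> x * w1 + y * w2 \<Longrightarrow>
      (x - 2 * (x * w1 + y * w2 - l) * w1, y - 2 * (x * w1 + y * w2 - l) * w2) \<in> T"
  shows "p * w1 + q * w2 \<le> l"
proof (rule ccontr)
  assume "\<not> p * w1 + q * w2 \<le> l"
  then have l: "l < p * w1 + q * w2" by simp
  have h0: "h > 0" using t h by simp
  have ht: "h \<le> t / 4"
    using mult_left_mono[of t "1/4" t] t unfolding h power2_eq_square by simp
  define dA dB dC where "dA = - l" and "dB = w1 - l" and "dC = t * w1 + h * w2 - l"
  have fA: "0 \<le> - (2 * dA * w2)" "t * (- (2 * dA * w2)) \<le> h * (- (2 * dA * w1))"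
    if "0 \<le> dA"
    using fold[of 0 0] that by (auto simp: T_def dA_def)
  have fB: "0 \<le> - (2 * dB * w2)" "t * (- (2 * dB * w2)) \<le> h * (1 - 2 * dB * w1)"
    "(1 - t) * (- (2 * dB * w2)) \<le> h * (2 * dB * w1)" if "0 \<le> dB"
    using fold[of 1 0] that by (auto simp: T_def dB_def)
  have fC: "0 \<le> h - 2 * dC * w2" "(1 - t) * (h - 2 * dC * w2) \<le> h * (1 - (t - 2 * dC * w1))"
    if "0 \<le> dC"
    using fold[of t h] that by (auto simp: T_def dC_def)
  have "h * (1 - p) \<le> h * 1" using h0 p t by (intro mult_left_mono) auto
  then have pq: "2 * q \<le> h" using q by simp
  show False
  proof (cases "0 \<le> w1"; cases "w2 \<le> 0")
    assume w1: "0 \<le> w1" and w2: "w2 \<le> 0"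
    have "q * w2 \<le> 0" using q w2 by (simp add: mult_nonneg_nonpos)
    then have dB: "(1 - p) * w1 < dB" using l by (simp add: dB_def algebra_simps)
    moreover have "0 \<le> (1 - p) * w1" using p t w1 by simp
    ultimately have dB0: "dB > 0" by linarith
    have "dB * ((1 - t) * (- w2)) \<le> dB * (h * w1)" using fB(3) dB0 by (simp add: algebra_simps)
    then have s: "(1 - t) * (- w2) \<le> h * w1" using dB0 by (simp only: mult_le_cancel_left_pos)
    have "(1/2) * (- w2) \<le> (1 - t) * (- w2)" using t w2 by (intro mult_right_mono) auto
    then have "- w2 \<le> 2 * h * w1" using s by linarith
    then have "(- w2)\<^sup>2 \<le> (2 * h * w1)\<^sup>2" using w2 by (intro power_mono) auto
    then have "w2\<^sup>2 \<le> 4 * h\<^sup>2 * w1\<^sup>2" by (simp add: power_mult_distrib)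
    then have a: "1 \<le> (1 + 4 * h\<^sup>2) * w1\<^sup>2" using w by (simp add: algebra_simps)
    then have w1p: "w1\<^sup>2 > 0" by (cases "w1 = 0") auto
    have "0 \<le> t * (- (2 * dB * w2))" using fB(1) dB0 t by (intro mult_nonneg_nonneg) auto
    then have "0 \<le> h * (1 - 2 * dB * w1)" using fB(2) dB0 by linarith
    then have "2 * (dB * w1) \<le> 1" using h0 by (simp add: zero_le_mult_iff)
    moreover have "((1 - p) * w1) * w1 \<le> dB * w1" using dB w1 by (intro mult_right_mono) auto
    moreover have "2 * (1 - p) * w1\<^sup>2 = 2 * (((1 - p) * w1) * w1)" by (simp add: power2_eq_square)
    ultimately have "2 * (1 - p) * w1\<^sup>2 \<le> 1" by linarith
    moreover have "(1 + 2 * t) * w1\<^sup>2 \<le> 2 * (1 - p) * w1\<^sup>2" using p by (intro mult_right_mono) auto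
    ultimately have b: "(1 + 2 * t) * w1\<^sup>2 \<le> 1" by linarith
    have "4 * h\<^sup>2 < 2 * t"
    proof -
      have "h * h \<le> t / 4 * 1" using ht h0 t by (intro mult_mono) auto
      then show ?thesis using t by (simp add: power2_eq_square)
    qed
    then have "(1 + 4 * h\<^sup>2) * w1\<^sup>2 < (1 + 2 * t) * w1\<^sup>2" using w1p by simp
    then show False using a b by linarith
  next
    assume w1: "0 \<le> w1" and "\<not> w2 \<le> 0"
    then have w2: "w2 > 0" by simp
    have dB: "dB \<le> 0"
    proof (rule ccontr)
      assume "\<not> dB \<le> 0"
      then have "0 < dB * w2" "0 \<le> - (2 * dB * w2)" using w2 fB(1) by simp_all
      then show False by linarith
    qed
    then have qw: "(1 - p) * w1 < q * w2" using l by (simp add: dB_def algebra_simps)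
    have p1: "1 - p > 0" "p - t \<ge> 0" using p t by auto
    have dC: "(h - q) * w2 - (p - t) * w1 < dC" using l by (simp add: dC_def algebra_simps)
    have "2 * q * w2 \<le> h * (1 - p) * w2" using q w2 by (intro mult_right_mono) auto
    then have "(1 - p) * (2 * w1) < (1 - p) * (h * w2)" using qw by (simp add: algebra_simps)
    then have w1h: "2 * w1 < h * w2" using p1 by (simp only: mult_less_cancel_left_pos)
    have "q * 2 + (p - t) * h \<le> h * (1 - p) + (p - t) * h" using q by simp
    then have e1: "2 * q + (p - t) * h \<le> h * (1 - t)" by (simp add: algebra_simps)
    have "(p - t) * (2 * w1) \<le> (p - t) * (h * w2)" using p1 w1h by (intro mult_left_mono) auto
    moreover have "(2 * q + (p - t) * h) * w2 \<le> h * (1 - t) * w2"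
      using e1 w2 by (intro mult_right_mono) auto
    ultimately have dC': "h * (1 + t) * w2 < 2 * dC" using dC by (simp add: algebra_simps)
    moreover have "h * (1 + t) * w2 > 0" using h0 t w2 by simp
    ultimately have "dC > 0" by linarith
    then have "2 * dC * w2 \<le> h" using fC(1) by simp
    moreover have "h * (1 + t) * w2 * w2 < 2 * dC * w2" using dC' w2 by (intro mult_strict_right_mono) auto
    ultimately have "h * ((1 + t) * w2\<^sup>2) < h * 1" by (simp add: power2_eq_square algebra_simps)
    then have a: "(1 + t) * w2\<^sup>2 < 1" using h0 by (simp only: mult_less_cancel_left_pos)
    have "w1\<^sup>2 \<le> (h * w2)\<^sup>2" using w1 w1h by (intro power_mono) auto
    moreover have "h\<^sup>2 \<le> t"
    proof -
      have "h * h \<le> t * 1" using ht h0 t by (intro mult_mono) auto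
      then show ?thesis by (simp add: power2_eq_square)
    qed
    then have "h\<^sup>2 * w2\<^sup>2 \<le> t * w2\<^sup>2" by (intro mult_right_mono) auto
    ultimately have "w1\<^sup>2 \<le> t * w2\<^sup>2" by (simp add: power_mult_distrib)
    then show False using a w by (simp add: algebra_simps)
  next
    assume "\<not> 0 \<le> w1" and w2: "w2 \<le> 0"
    then have w1: "w1 < 0" by simp
    have qw: "q * w2 \<le> 0" using q w2 by (simp add: mult_nonneg_nonpos)
    have "(2 * t) * (- w1) \<le> p * (- w1)" using p w1 by (intro mult_right_mono) auto
    then have dA: "2 * t * (- w1) < dA" using l qw by (simp add: dA_def)
    moreover have "2 * t * (- w1) > 0" using t w1 by (simp add: mult_pos_neg)
    ultimately have dA0: "dA > 0" by linarith
    have "dA * (t * (- w2)) \<le> dA * (h * (- w1))" using fA(2) dA0 by (simp add: algebra_simps)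
    then have "t * (- w2) \<le> h * (- w1)" using dA0 by (simp only: mult_le_cancel_left_pos)
    then have "t * (- w2) \<le> t * (t * (- w1))" by (simp add: h power2_eq_square algebra_simps)
    then have "- w2 \<le> t * (- w1)" using t by (simp only: mult_le_cancel_left_pos)
    then have "h * (- w2) \<le> h * (t * (- w1))" using h0 by (intro mult_left_mono) auto
    moreover have "h * (t * (- w1)) \<le> 1 * (t * (- w1))"
      using ht t w1 by (intro mult_right_mono) (auto simp: mult_nonneg_nonpos)
    ultimately have dC0: "dC > 0" using dA by (simp add: dC_def dA_def)
    have "0 < 2 * dC * (- w1)" using dC0 w1 by (intro mult_pos_pos) auto
    then have "h * (1 - (t - 2 * dC * w1)) < (1 - t) * h"
      using h0 mult_strict_left_mono[of 0 "2 * dC * (- w1)" h] by (simp add: algebra_simps)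
    moreover have "(1 - t) * h \<le> (1 - t) * (h - 2 * dC * w2)"
      using t dC0 w2 by (intro mult_left_mono) (auto simp: mult_nonneg_nonpos)
    ultimately show False using fC(2) dC0 by linarith
  next
    assume "\<not> 0 \<le> w1" and "\<not> w2 \<le> 0"
    then have w1: "w1 < 0" and w2: "w2 > 0" by auto
    have dA: "dA \<le> 0"
    proof (rule ccontr)
      assume "\<not> dA \<le> 0"
      then have "0 < dA * w2" "0 \<le> - (2 * dA * w2)" using w2 fA(1) by simp_all
      then show False by linarith
    qed
    then have qw: "p * (- w1) < q * w2" using l by (simp add: dA_def)
    have p1: "p - t > 0" using p t by simp
    have dC: "(h - q) * w2 + (p - t) * (- w1) < dC" using l by (simp add: dC_def algebra_simps)
    moreover have "0 \<le> (p - t) * (- w1)" using p1 w1 by (intro mult_nonneg_nonneg) auto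
    ultimately have dC': "(h - q) * w2 < dC" by linarith
    have "h * (1 - p) \<le> h * (1 - t)" using p t h0 by (intro mult_left_mono) auto
    then have e1: "h * (1 + t) \<le> 2 * (h - q)" using q by (simp add: algebra_simps)
    have "0 < h * (1 + t)" using h0 t by simp
    then have "0 < (h - q) * w2" using e1 w2 by simp
    then have "dC > 0" using dC' by linarith
    then have "2 * dC * w2 \<le> h" using fC(1) by simp
    moreover have "(h * (1 + t)) * (w2 * w2) \<le> (2 * (h - q)) * (w2 * w2)"
      using e1 by (intro mult_right_mono) auto
    moreover have "(h - q) * w2 * w2 < dC * w2" using dC' w2 by (intro mult_strict_right_mono) auto
    ultimately have "h * ((1 + t) * w2\<^sup>2) < h * 1" by (simp add: power2_eq_square algebra_simps)
    then have a: "(1 + t) * w2\<^sup>2 < 1" using h0 by (simp only: mult_less_cancel_left_pos)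
    have "(2 * t) * (- w1) \<le> p * (- w1)" using p w1 by (intro mult_right_mono) auto
    moreover have "2 * q * w2 \<le> h * w2" using pq w2 by (intro mult_right_mono) auto
    ultimately have "t * (4 * (- w1)) \<le> t * (t * w2)"
      using qw by (simp add: h power2_eq_square algebra_simps)
    then have "4 * (- w1) \<le> t * w2" using t by (simp only: mult_le_cancel_left_pos)
    then have "- w1 \<le> t * w2" using w1 by linarith
    then have "(- w1)\<^sup>2 \<le> (t * w2)\<^sup>2" using w1 by (intro power_mono) auto
    moreover have "t\<^sup>2 \<le> t" using t by (simp add: power2_eq_square mult_left_le)
    then have "t\<^sup>2 * w2\<^sup>2 \<le> t * w2\<^sup>2" by (intro mult_right_mono) auto
    ultimately have "w1\<^sup>2 \<le> t * w2\<^sup>2" by (simp add: power_mult_distrib)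
    then show False using a w by (simp add: algebra_simps)
  qed
qed

text \<open>The height \<open>t\<^sup>2\<close> makes the triangle obtuse at its apex and flat compared with the distance
  \<open>t\<close> of the apex from the left vertex.\<close>

definition flat_triangle :: "real \<Rightarrow> plane set" where
  "flat_triangle t = convex hull {0, vector [1, 0], vector [t, t\<^sup>2]}"

lemma vector_frame: "(vector [x, c * h] :: plane) = 0 + x *\<^sub>R vector [1, 0] + c *\<^sub>R vector [0, h]"
  by (simp add: vec_eq_iff forall_2)

lemma flat_triangle_iff:
  assumes t: "t > 0"
  shows "P \<in> flat_triangle t \<longleftrightarrow>
    0 \<le> P $ 2 \<and> t * P $ 2 \<le> t\<^sup>2 * P $ 1 \<and> (1 - t) * P $ 2 \<le> t\<^sup>2 * (1 - P $ 1)"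
proof
  have T: "flat_triangle t = convex hull {0, 0 + vector [1, 0], 0 + t *\<^sub>R vector [1, 0] + vector [0, t\<^sup>2]}"
    using vector_frame[of t 1 "t\<^sup>2"] by (simp add: flat_triangle_def)
  have t2: "t\<^sup>2 > 0" using t by simp
  {
    assume "P \<in> flat_triangle t"
    then obtain x c where *: "P = 0 + x *\<^sub>R vector [1, 0] + c *\<^sub>R vector [0, t\<^sup>2]"
      "0 \<le> c" "t * c \<le> x" "x \<le> 1 - (1 - t) * c"
      unfolding T by (rule frame_triangle_mem)
    have "t\<^sup>2 * (t * c) \<le> t\<^sup>2 * x" "t\<^sup>2 * ((1 - t) * c) \<le> t\<^sup>2 * (1 - x)"
      using * by (intro mult_left_mono; simp)+
    then show "0 \<le> P $ 2 \<and> t * P $ 2 \<le> t\<^sup>2 * P $ 1 \<and> (1 - t) * P $ 2 \<le> t\<^sup>2 * (1 - P $ 1)"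
      using * by (simp add: mult_ac)
  next
    assume P: "0 \<le> P $ 2 \<and> t * P $ 2 \<le> t\<^sup>2 * P $ 1 \<and> (1 - t) * P $ 2 \<le> t\<^sup>2 * (1 - P $ 1)"
    define c where "c = P $ 2 / t\<^sup>2"
    have c: "P $ 2 = c * t\<^sup>2" using t2 by (simp add: c_def)
    have "t\<^sup>2 * (t * c) \<le> t\<^sup>2 * P $ 1" "t\<^sup>2 * ((1 - t) * c) \<le> t\<^sup>2 * (1 - P $ 1)"
      using P unfolding c by (simp_all add: mult_ac)
    then have "t * c \<le> P $ 1" "(1 - t) * c \<le> 1 - P $ 1" using t2 by (simp_all only: mult_le_cancel_left_pos)
    moreover have "0 \<le> c" using P by (simp add: c_def)
    ultimately have "0 + (P $ 1) *\<^sub>R vector [1, 0] + c *\<^sub>R vector [0, t\<^sup>2] \<in> flat_triangle t"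
      unfolding T by (intro frame_triangle_memI) auto
    moreover have "P = vector [P $ 1, c * t\<^sup>2]" using c by (simp add: vec_eq_iff forall_2)
    ultimately show "P \<in> flat_triangle t" unfolding vector_frame by simp
  }
qed

lemma deep_points_in_heart:
  assumes t: "0 < t" "t \<le> 1/4"
    and p: "2 * t \<le> p" "p \<le> 1/2 - t" and q: "0 \<le> q" "2 * q \<le> t\<^sup>2 * (1 - p)"
  shows "vector [p, q] \<in> heart (flat_triangle t)"
proof -
  let ?K = "flat_triangle t"
  have K: "compact ?K" "?K \<noteq> {}" by (auto simp: flat_triangle_def finite_imp_compact_convex_hull)
  have "vector [p, q] \<in> ?K"
  proof -
    have "t\<^sup>2 * (1 - p) \<le> t\<^sup>2 * 1" using p t by (intro mult_left_mono) auto
    then have "q \<le> t\<^sup>2 / 2" using q by linarith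
    then have "t * q \<le> t * (t\<^sup>2 / 2)" using t by (intro mult_left_mono) auto
    also have "\<dots> = t\<^sup>2 * (t / 2)" by simp
    also have "\<dots> \<le> t\<^sup>2 * p" using p t by (intro mult_left_mono) auto
    finally have "t * q \<le> t\<^sup>2 * p" .
    moreover have "(1 - t) * q \<le> 1 * q" using t q by (intro mult_right_mono) auto
    then have "(1 - t) * q \<le> t\<^sup>2 * (1 - p)" using q by linarith
    ultimately show ?thesis using q t by (simp add: flat_triangle_iff)
  qed
  moreover have "vector [p, q] \<bullet> \<omega> \<le> l"
    if \<omega>: "norm \<omega> = 1" and fold: "reflection l \<omega> ` cap ?K l \<omega> \<subseteq> ?K" for \<omega> l
  proof -
    have ip: "(vector [x, y] :: plane) \<bullet> \<omega> = x * \<omega> $ 1 + y * \<omega> $ 2" for x y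
      by (simp add: inner_vec_def sum_2)
    have "(\<omega> $ 1)\<^sup>2 + (\<omega> $ 2)\<^sup>2 = 1"
      using \<omega> by (simp add: norm_eq_1 inner_vec_def sum_2 power2_eq_square)
    moreover have "(x - 2 * (x * \<omega> $ 1 + y * \<omega> $ 2 - l) * \<omega> $ 1, y - 2 * (x * \<omega> $ 1 + y * \<omega> $ 2 - l) * \<omega> $ 2)
        \<in> {(x, y). 0 \<le> y \<and> t * y \<le> t\<^sup>2 * x \<and> (1 - t) * y \<le> t\<^sup>2 * (1 - x)}"
      if "(x, y) \<in> {(0, 0), (1, 0), (t, t\<^sup>2)}" "l \<le> x * \<omega> $ 1 + y * \<omega> $ 2" for x y
    proof -
      have "vector [x, y] \<in> ?K"
        using that(1) t by (auto simp: flat_triangle_iff mult_ac power2_eq_square)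
      then have "reflection l \<omega> (vector [x, y]) \<in> ?K"
        using fold that(2) by (auto simp: cap_def ip)
      then show ?thesis using t unfolding flat_triangle_iff[OF t(1)] reflection_def ip by simp
    qed
    ultimately show ?thesis
      unfolding ip by (intro fold_exposing_deep_point_fails[OF t refl p q]) auto
  qed
  ultimately show ?thesis unfolding heart_iff[OF K] by blast
qed

text \<open>The trapezoid of points known to be in the heart is a triangle with apex \<open>(1, 0)\<close> without a
  smaller homothetic one. Subadditivity of the area then bounds the heart from below by the
  difference of the two areas, and no triangulation is necessary.\<close>

lemma flat_triangle_ratio_ge:
  assumes t: "0 < t" "t \<le> 1/4"
  shows "((1 - 2 * t)\<^sup>2 - (1/2 + t)\<^sup>2) / 2 \<le> area (heart (flat_triangle t)) / area (flat_triangle t)"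
proof -
  let ?X = "\<lambda>x c. 0 + x *\<^sub>R vector [1, 0] + c *\<^sub>R vector [0, t\<^sup>2] :: plane"
  define S where "S s = convex hull {?X s 0, ?X 1 0, ?X s ((1 - s) / 2)}" for s
  have t2: "t\<^sup>2 > 0" using t by simp
  have area_S: "area (S s) = t\<^sup>2 * (1 - s)\<^sup>2 / 4" if "s \<le> 1" for s
    unfolding S_def area_frame_triangle using that by (simp add: power2_eq_square abs_mult)
  have area_K: "area (flat_triangle t) = t\<^sup>2 / 2"
    using area_frame_triangle[of 0 0 "vector [1, 0]" 0 "vector [0, t\<^sup>2]" 1 0 t 1] vector_frame[of t 1 "t\<^sup>2"]
    by (simp add: flat_triangle_def)
  have "S (2 * t) \<subseteq> heart (flat_triangle t) \<union> S (1/2 - t)"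
  proof
    fix P assume "P \<in> S (2 * t)"
    then obtain u v w where uvw: "0 \<le> u" "0 \<le> v" "0 \<le> w" "u + v + w = 1"
      "P = u *\<^sub>R ?X (2 * t) 0 + v *\<^sub>R ?X 1 0 + w *\<^sub>R ?X (2 * t) ((1 - 2 * t) / 2)"
      unfolding S_def convex_hull_3 by blast
    define x c where "x = 2 * t * (1 - v) + v" and "c = w * (1 - 2 * t) / 2"
    have u: "u = 1 - v - w" using uvw(4) by simp
    have P: "P = ?X x c" unfolding uvw(5) u x_def c_def
      by (simp add: vec_eq_iff forall_2 algebra_simps)
    have x: "2 * t \<le> x" "x \<le> 1"
      using mult_nonneg_nonneg[of "1 - 2 * t" v] mult_nonneg_nonneg[of "1 - 2 * t" "1 - v"] uvw t
      by (auto simp: x_def algebra_simps)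
    have "1 - x - 2 * c = (1 - 2 * t) * u" unfolding u x_def c_def by (simp add: field_simps)
    moreover have "0 \<le> (1 - 2 * t) * u" using uvw(1) t by (intro mult_nonneg_nonneg) auto
    ultimately have c: "0 \<le> c" "2 * c \<le> 1 - x" using uvw(3) t by (auto simp: c_def)
    show "P \<in> heart (flat_triangle t) \<union> S (1/2 - t)"
    proof (cases "x \<le> 1/2 - t")
      case True
      have "2 * (c * t\<^sup>2) \<le> t\<^sup>2 * (1 - x)"
        using mult_left_mono[OF c(2), of "t\<^sup>2"] by (simp add: mult_ac)
      then have "vector [x, c * t\<^sup>2] \<in> heart (flat_triangle t)"
        using True x c t by (intro deep_points_in_heart) auto
      then show ?thesis unfolding P vector_frame by simp
    next
      case False
      define r where "r = 1/2 + t"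
      have r: "r > 0" "1/2 - t = 1 - r" using t by (auto simp: r_def)
      have "?X x c \<in> S (1/2 - t)"
        unfolding S_def r(2)
        using False x c r by (intro frame_in_hull[of "(1 - x - 2 * c) / r" "1 - (1 - x) / r" "2 * c / r"])
          (auto simp: r_def[symmetric] field_simps)
      then show ?thesis using P by simp
    qed
  qed
  moreover have mh: "heart (flat_triangle t) \<in> lmeasurable"
    by (intro lmeasurable_compact compact_heart) (simp add: flat_triangle_def finite_imp_compact_convex_hull)
  ultimately have "area (S (2 * t)) \<le> area (heart (flat_triangle t) \<union> S (1/2 - t))"
    unfolding area_def S_def
    by (intro measure_mono_fmeasurable fmeasurable.Un lmeasurable_hull3 fmeasurableD)
  also have "\<dots> \<le> area (heart (flat_triangle t)) + area (S (1/2 - t))"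
    unfolding area_def using mh by (intro measure_Un_le fmeasurableD) (auto simp: S_def lmeasurable_hull3)
  finally have "t\<^sup>2 * (1 - 2 * t)\<^sup>2 / 4 - t\<^sup>2 * (1/2 + t)\<^sup>2 / 4 \<le> area (heart (flat_triangle t))"
    using t by (simp add: area_S)
  then show ?thesis unfolding area_K using t2 by (simp add: field_simps)
qed

lemma flat_triangle_obtuse:
  assumes t: "0 < t" "t \<le> 1/4"
  shows "is_obtuse_triangle (flat_triangle t)"
proof -
  define a b c :: plane where "a = vector [t, t\<^sup>2]" and "b = 0" and "c = vector [1, 0]"
  have "\<not> collinear {0, c, a}"
    unfolding collinear_lemma using t by (auto simp: a_def c_def vec_eq_iff forall_2)
  then have nc: "\<not> collinear {a, b, c}" by (simp add: b_def insert_commute)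
  have "(b - a) \<bullet> (c - a) = t * (t - 1 + t ^ 3)"
    by (simp add: a_def b_def c_def inner_vec_def sum_2 power2_eq_square power3_eq_cube algebra_simps)
  moreover have "t ^ 3 \<le> (1/4) ^ 3" using t by (intro power_mono) auto
  then have "t * (t - 1 + t ^ 3) < 0" using t by (intro mult_pos_neg) (auto simp: power3_eq_cube)
  ultimately have neg: "(b - a) \<bullet> (c - a) < 0" by simp
  have "b \<noteq> a" "c \<noteq> a" using nc by (auto simp: insert_commute[of a b])
  then have pos: "norm (b - a) * norm (c - a) > 0" by simp
  define k where "k = ((b - a) \<bullet> (c - a)) / (norm (b - a) * norm (c - a))"
  have "k < 0" unfolding k_def using neg pos by (rule divide_neg_pos)
  moreover have "-1 \<le> k"
    unfolding k_def using Cauchy_Schwarz_ineq2[of "b - a" "c - a"] pos by (simp add: field_simps)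
  ultimately have "arccos 0 < arccos k" by (intro arccos_less_arccos) auto
  then have "angle_at a b c > pi / 2" by (simp add: angle_at_def k_def arccos_0)
  moreover have "flat_triangle t = convex hull {a, b, c}"
    by (simp add: flat_triangle_def a_def b_def c_def insert_commute)
  ultimately show ?thesis using nc unfolding is_obtuse_triangle_def by blast
qed

section \<open>The supremum\<close>

theorem theorem4p2:
  shows "bdd_above {area (heart K) / area K | K. is_triangle K} \<and>
         Sup {area (heart K) / area K | K. is_triangle K} = 3 / 8 \<and>
         (\<exists>K :: nat \<Rightarrow> (real^2) set. (\<forall>n. is_obtuse_triangle (K n)) \<and>
            (\<lambda>n. area (heart (K n)) / area (K n)) \<longlonglongrightarrow> 3 / 8)"
proof -
  let ?R = "{area (heart K) / area K | K. is_triangle K}"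
  have ub: "r \<le> 3 / 8" if "r \<in> ?R" for r using that heart_ratio_le by auto
  then have bdd: "bdd_above ?R" by (rule bdd_aboveI)
  define \<tau> :: "nat \<Rightarrow> real" where "\<tau> n = 1 / real (n + 4)" for n
  define K where "K n = flat_triangle (\<tau> n)" for n
  have \<tau>: "0 < \<tau> n" "\<tau> n \<le> 1/4" for n by (auto simp: \<tau>_def field_simps)
  have \<tau>_lim: "\<tau> \<longlonglongrightarrow> 0" unfolding \<tau>_def by (rule LIMSEQ_ignore_initial_segment[OF lim_1_over_n])
  have obtuse: "is_obtuse_triangle (K n)" for n unfolding K_def using \<tau> by (intro flat_triangle_obtuse)
  then have tri: "is_triangle (K n)" for n unfolding is_obtuse_triangle_def is_triangle_def by blast
  have lim: "(\<lambda>n. area (heart (K n)) / area (K n)) \<longlonglongrightarrow> 3 / 8"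
  proof (rule tendsto_sandwich)
    have "(\<lambda>n. ((1 - 2 * \<tau> n)\<^sup>2 - (1/2 + \<tau> n)\<^sup>2) / 2) \<longlonglongrightarrow> ((1 - 2 * 0)\<^sup>2 - (1/2 + 0)\<^sup>2) / 2"
      by (intro tendsto_intros \<tau>_lim) simp
    then show "(\<lambda>n. ((1 - 2 * \<tau> n)\<^sup>2 - (1/2 + \<tau> n)\<^sup>2) / 2) \<longlonglongrightarrow> 3 / 8"
      by (simp add: power2_eq_square)
    show "\<forall>\<^sub>F n in sequentially. ((1 - 2 * \<tau> n)\<^sup>2 - (1/2 + \<tau> n)\<^sup>2) / 2 \<le> area (heart (K n)) / area (K n)"
      unfolding K_def using \<tau> by (intro always_eventually allI flat_triangle_ratio_ge)
    show "\<forall>\<^sub>F n in sequentially. area (heart (K n)) / area (K n) \<le> 3 / 8"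
      using tri by (intro always_eventually allI heart_ratio_le)
  qed simp
  have "Sup ?R = 3 / 8"
  proof (rule antisym)
    show "Sup ?R \<le> 3 / 8" using tri ub by (intro cSup_least) auto
    have "area (heart (K n)) / area (K n) \<le> Sup ?R" for n
      using tri bdd by (intro cSup_upper) auto
    then show "3 / 8 \<le> Sup ?R" using lim by (intro LIMSEQ_le_const2) auto
  qed
  then show ?thesis using bdd obtuse lim by blast
qed

end
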